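(* Let $Q\subset\mathbb{R}^2$ be a convex polygon, let $P=(p_1,\dots,p_n)\in Q^n$, and assume $0\in\operatorname{int}(\partial\mathcal{H}_{\mathrm{SP}}(P))$ (interior in $(\mathbb{R}^2)^n$). Then $P$ is a strict local maximum of $\mathcal{H}_{\mathrm{SP}}$, all generators are active (that is, $F_i(P)=\mathcal{H}_{\mathrm{SP}}(P)$ for all $i\in\{1,\dots,n\}$), and $P$ is a generic incenter Voronoi configuration (that is, $\operatorname{IC}(V_i(P))=\{p_i\}$ for all $i\in\{1,\dots,n\}$).
   Context: $\|\cdot\|$ is the Euclidean norm, $\operatorname{Ed}(Q)$ is the set of edges of $Q$, and $\operatorname{D}_e(p)$ is the distance from $p$ to $e$. For $P=(p_1,\dots,p_n)\in Q^n$, the Voronoi cells are $V_i(P)=\{q\in Q : \|q-p_i\|\le\|q-p_j\|\ \forall j\ne i\}$. The multi-incenter function is $\mathcal{H}_{\mathrm{SP}}(P)=\min\{\tfrac12\|p_i-p_j\|,\ \operatorname{D}_e(p_i) : i,j\in\{1,\dots,n\},\ i\ne j,\ e\in\operatorname{Ed}(Q)\}$, and $F_i(P)=\min_{q\notin\operatorname{int}(V_i(P))}\|q-p_i\|$; the paper writes $\mathcal{H}_{\mathrm{SP}}(P)=\min_i F_i(P)$. The generator $p_i$ is active at $P$ if $F_i(P)=\mathcal{H}_{\mathrm{SP}}(P)$. The incenter set $\operatorname{IC}(W)$ of a polytope $W$ is the set of centers of maximum-radius spheres (disks) contained in $W$. For a locally Lipschitz function $f$, the (Clarke) generalized gradient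 is $\partial f(x)=\operatorname{co}\{\lim_{i\to\infty}df(x_i) : x_i\to x,\ x_i\notin S\cup\Omega_f\}$, where $\Omega_f$ is the set of points where $f$ is not differentiable, $S$ is any set of measure zero, and $\operatorname{co}$ is the convex hull. *)

theory Defs
  imports "HOL-Analysis.Analysis"
begin

definition convex_polygon :: "(real^2) set \<Rightarrow> bool" where
  "convex_polygon Q \<longleftrightarrow> polytope Q \<and> interior Q \<noteq> {}"

definition configurations :: "(real^2) set \<Rightarrow> ((real^2)^'n) set" where
  "configurations Q = {P. \<forall>i. P $ i \<in> Q}"

definition voronoi_cell :: "(real^2) set \<Rightarrow> (real^2)^'n \<Rightarrow> 'n \<Rightarrow> (real^2) set" where
  "voronoi_cell Q P i =
     {q \<in> Q. \<forall>j. j \<noteq> i \<longrightarrow> norm (q - P $ i) \<le> norm (q - P $ j)}"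

(* A polytope has finitely many faces, so for a convex polygon Q this is the minimum
   of a finite nonempty set. *)
definition H_SP :: "(real^2) set \<Rightarrow> (real^2)^'n \<Rightarrow> real" where
  "H_SP Q P = Min ({1/2 * norm (P $ i - P $ j) | i j. i \<noteq> j}
                 \<union> {infdist (P $ i) e | i e. e edge_of Q})"

(* The complement of the interior is closed and (Q being bounded) nonempty, so the
   infimum in infdist is attained. *)
definition F_SP :: "(real^2) set \<Rightarrow> (real^2)^'n \<Rightarrow> 'n \<Rightarrow> real" where
  "F_SP Q P i = infdist (P $ i) (- interior (voronoi_cell Q P i))"

definition active :: "(real^2) set \<Rightarrow> (real^2)^'n \<Rightarrow> 'n \<Rightarrow> bool" where
  "active Q P i \<longleftrightarrow> F_SP Q P i = H_SP Q P"

definition incenter_set :: "'a::metric_space set \<Rightarrow> 'a set" where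
  "incenter_set W =
     {c. \<exists>r\<ge>0. cball c r \<subseteq> W \<and> (\<forall>c' r'. r' \<ge> 0 \<and> cball c' r' \<subseteq> W \<longrightarrow> r' \<le> r)}"

definition generic_incenter_voronoi :: "(real^2) set \<Rightarrow> (real^2)^'n \<Rightarrow> bool" where
  "generic_incenter_voronoi Q P \<longleftrightarrow>
     (\<forall>i. incenter_set (voronoi_cell Q P i) = {P $ i})"

(* The function f is only meaningful on the domain D, so its gradient is taken at interior
   points of D; values that the total HOL function f has outside D play no role. For x
   in the interior of D this is the usual generalized gradient, and it also makes sense for
   x on the boundary of D. S is the exceptional set of measure zero. *)
definition clarke_gradient ::
    "'a::real_inner set \<Rightarrow> 'a set \<Rightarrow> ('a \<Rightarrow> real) \<Rightarrow> 'a \<Rightarrow> 'a set" where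
  "clarke_gradient D S f x = convex hull
     {g. \<exists>X df. (\<forall>k. X k \<in> interior D \<and> X k \<notin> S \<and> GDERIV f (X k) :> df k)
              \<and> X \<longlonglongrightarrow> x \<and> df \<longlonglongrightarrow> g}"

definition strict_local_max_on ::
    "'a::metric_space set \<Rightarrow> ('a \<Rightarrow> real) \<Rightarrow> 'a \<Rightarrow> bool" where
  "strict_local_max_on D f x \<longleftrightarrow>
     x \<in> D \<and> (\<exists>\<epsilon>>0. \<forall>y\<in>D. y \<noteq> x \<and> dist y x < \<epsilon> \<longrightarrow> f y < f x)"

end

theory Submission
  imports Defs
begin

text \<open>
  On \<open>Q\<close> the smallest distance to an edge equals the smallest slack \<open>b - a \<bullet> p\<close> over the
  supporting lines of the edges, so the multi-incenter function is a finite minimum of smooth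
  constraints (away from coinciding generators), and each limit gradient \<open>g\<close> at \<open>P\<close> is the
  gradient of one constraint active at \<open>P\<close>. If \<open>0\<close> is interior to their convex hull,
  then for some \<open>\<epsilon> > 0\<close> every direction \<open>v\<close> admits such a \<open>g\<close> with
  \<open>g \<bullet> v \<le> - \<epsilon> * norm v\<close>. The slacks are affine and the pair distances have a quadratic
  remainder, so \<open>P\<close> is a strict local maximum. Moving only the generator \<open>i\<close> in
  direction \<open>w\<close> yields a constraint that bounds the cell of \<open>i\<close> by a line at distance exactly
  \<open>H_SP Q P\<close> whose outer normal has positive product with \<open>w\<close>; hence \<open>i\<close> is active, and
  shifting the center of the inscribed disk by \<open>w\<close> forces a smaller radius.
\<close>

section \<open>Edges of a convex polygon\<close>

lemma convex_polygonD:
  assumes "convex_polygon Q"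
  shows "convex Q" "compact Q" "closed Q" "finite {e. e edge_of Q}"
proof -
  have Q: "polytope Q" using assms by (simp add: convex_polygon_def)
  then show "convex Q" "compact Q" "closed Q"
    by (auto simp: polytope_imp_convex polytope_imp_compact polytope_imp_closed)
  show "finite {e. e edge_of Q}"
    using finite_polytope_faces[OF Q] by (rule finite_subset[rotated]) (auto simp: edge_of_def)
qed

text \<open>A nonempty interior makes \<open>Q\<close> two-dimensional, so its facets are exactly
  its edges.\<close>

lemma frontier_convex_polygon:
  assumes "convex_polygon Q"
  shows "frontier Q = \<Union>{e. e edge_of Q}"
proof -
  have dim: "aff_dim Q = 2"
    using assms aff_dim_nonempty_interior[of Q] by (simp add: convex_polygon_def)
  have "frontier Q = rel_frontier Q"
    using assms by (simp add: convex_polygon_def rel_frontier_nonempty_interior)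
  also have "\<dots> = \<Union>{F. F facet_of Q}"
    using assms by (intro rel_frontier_of_polyhedron)
      (simp add: convex_polygon_def polytope_imp_polyhedron)
  also have "{F. F facet_of Q} = {e. e edge_of Q}"
    using dim by (auto simp: facet_of_def edge_of_def)
  finally show ?thesis .
qed

lemma edge_nonempty: "e edge_of Q \<Longrightarrow> e \<noteq> {}"
  by (auto simp: edge_of_def)

text \<open>Since \<open>a\<close> is a unit normal, \<open>b - a \<bullet> p\<close> is the
  distance from a point \<open>p\<close> of \<open>Q\<close> to the supporting line through
  \<open>e\<close>.\<close>

definition edge_line :: "(real^2) set \<Rightarrow> (real^2) set \<Rightarrow> real^2 \<Rightarrow> real \<Rightarrow> bool" where
  "edge_line Q e a b \<longleftrightarrow> norm a = 1 \<and> (\<forall>x\<in>Q. a \<bullet> x \<le> b) \<and> (\<forall>x\<in>e. a \<bullet> x = b)"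

lemma edge_line_exists:
  assumes Q: "convex_polygon Q" and e: "e edge_of Q"
  obtains a b where "edge_line Q e a b"
proof -
  have "aff_dim Q = 2"
    using Q aff_dim_nonempty_interior[of Q] by (simp add: convex_polygon_def)
  then have ne: "e \<noteq> Q" using e by (auto simp: edge_of_def)
  have "e exposed_face_of Q"
    using Q e exposed_face_of_polyhedron[of Q e]
    by (simp add: convex_polygon_def polytope_imp_polyhedron edge_of_def)
  then obtain a b where ab: "Q \<subseteq> {x. a \<bullet> x \<le> b}" "e = Q \<inter> {x. a \<bullet> x = b}"
    by (auto simp: exposed_face_of_def)
  \<comment> \<open>For \<open>a = 0\<close> the exposed face would be empty or all of
    \<open>Q\<close>.\<close>
  have "a \<noteq> 0"
    using ab ne edge_nonempty[OF e] by auto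
  have "edge_line Q e (a /\<^sub>R norm a) (b / norm a)"
    using ab \<open>a \<noteq> 0\<close> by (auto simp: edge_line_def divide_simps)
  then show thesis by (rule that)
qed

lemma slack_le_infdist:
  assumes "edge_line Q e a b" "e \<noteq> {}"
  shows "b - a \<bullet> p \<le> infdist p e"
  unfolding infdist_def using assms(2)
proof (simp, intro cINF_greatest)
  fix x assume "x \<in> e"
  then have "b - a \<bullet> p = a \<bullet> (x - p)"
    using assms(1) by (simp add: edge_line_def inner_diff_right)
  also have "\<dots> \<le> norm a * norm (x - p)" by (rule norm_cauchy_schwarz)
  finally show "b - a \<bullet> p \<le> dist p x"
    using assms(1) by (simp add: edge_line_def dist_norm norm_minus_commute)
qed

text \<open>The segment from \<open>p\<close> to \<open>q\<close> meets the frontier, hence an edge,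
  no farther away than \<open>q\<close>.\<close>

lemma infdist_edge_le_dist:
  assumes Q: "convex_polygon Q" and "p \<in> Q" "q \<notin> interior Q"
  obtains e where "e edge_of Q" "infdist p e \<le> dist p q"
proof -
  have "\<exists>x\<in>closed_segment p q. x \<in> frontier Q"
  proof (cases "q \<in> Q")
    case True
    then show ?thesis
      using assms convex_polygonD(3)[OF Q] by (auto simp: frontier_def)
  next
    case False
    then have "closed_segment p q - Q \<noteq> {}" "closed_segment p q \<inter> Q \<noteq> {}"
      using assms by auto
    then show ?thesis
      using connected_Int_frontier[OF connected_segment(1)[of p q]] by blast
  qed
  then obtain x e where x: "x \<in> closed_segment p q" "x \<in> e" "e edge_of Q"
    using frontier_convex_polygon[OF Q] by auto
  have "infdist p e \<le> dist p x" using x by (intro infdist_le)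
  also have "\<dots> \<le> dist p q"
    using dist_in_closed_segment[OF x(1)] by (simp add: dist_commute)
  finally show thesis using that x by blast
qed

text \<open>The foot of the perpendicular from \<open>p\<close> to the line of \<open>e\<close> may
  miss \<open>e\<close>, but some edge is met on the way to it. So the smallest slack and the
  smallest distance over all edges agree, although single terms may differ.\<close>

lemma infdist_edge_le_slack:
  assumes Q: "convex_polygon Q" and "p \<in> Q" and ab: "edge_line Q e a b"
  obtains e' where "e' edge_of Q" "infdist p e' \<le> b - a \<bullet> p"
proof -
  have a: "norm a = 1" "a \<noteq> 0" and s: "b - a \<bullet> p \<ge> 0"
    using assms by (auto simp: edge_line_def)
  define q where "q = p + (b - a \<bullet> p) *\<^sub>R a"
  have "a \<bullet> a = 1" using a(1) by (simp add: dot_square_norm)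
  then have "a \<bullet> q = b" by (simp add: q_def inner_add_right)
  moreover have "interior Q \<subseteq> {x. a \<bullet> x < b}"
    using ab interior_mono[of Q "{x. a \<bullet> x \<le> b}"] a by (auto simp: edge_line_def)
  ultimately have "q \<notin> interior Q" by auto
  from infdist_edge_le_dist[OF Q \<open>p \<in> Q\<close> this] show thesis
    using a s that by (auto simp: q_def dist_norm)
qed

lemma ball_subset_convex_polygon:
  assumes Q: "convex_polygon Q" and "p \<in> Q" and r: "\<And>e. e edge_of Q \<Longrightarrow> r \<le> infdist p e"
  shows "ball p r \<subseteq> Q"
proof
  fix q assume "q \<in> ball p r"
  then show "q \<in> Q"
    using infdist_edge_le_dist[OF Q \<open>p \<in> Q\<close>, of q] r interior_subset[of Q]
    by (metis mem_ball not_less order_trans subsetD)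
qed

section \<open>The multi-incenter function as a finite minimum\<close>

text \<open>Indexing the terms of the minimum, instead of collecting their values, lets one
  constraint be followed along a sequence of configurations.\<close>

definition constraints :: "(real^2) set \<Rightarrow> (('n \<times> 'n) + ('n \<times> (real^2) set)) set" where
  "constraints Q = Inl ` {(i, j). i \<noteq> j} \<union> Inr ` (UNIV \<times> {e. e edge_of Q})"

definition separation ::
    "('n \<times> 'n) + ('n \<times> (real^2) set) \<Rightarrow> (real^2)^'n \<Rightarrow> real" where
  "separation c P = (case c of Inl (i, j) \<Rightarrow> 1/2 * norm (P $ i - P $ j)
                             | Inr (i, e) \<Rightarrow> infdist (P $ i) e)"

lemma H_SP_eq_Min: "H_SP Q P = Min ((\<lambda>c. separation c P) ` constraints Q)"
proof -
  have "{1/2 * norm (P $ i - P $ j) | i j. i \<noteq> j} \<union> {infdist (P $ i) e | i e. e edge_of Q}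
     = (\<lambda>c. separation c P) ` constraints Q"
    unfolding constraints_def separation_def image_Un image_image
    by (rule arg_cong2[of _ _ _ _ "(\<union>)"]) (auto simp: image_iff, blast+)
  then show ?thesis by (simp add: H_SP_def)
qed

lemma finite_constraints:
  fixes Q :: "(real^2) set"
  assumes "convex_polygon Q"
  shows "finite (constraints Q :: (('n::finite \<times> 'n) + ('n \<times> (real^2) set)) set)"
  using convex_polygonD(4)[OF assms] by (simp add: constraints_def)

text \<open>A single generator forms no pair, but edges exist because the bounded set
  \<open>Q\<close> has a nonempty frontier.\<close>

lemma constraints_nonempty:
  fixes Q :: "(real^2) set"
  assumes "convex_polygon Q"
  shows "(constraints Q :: (('n::finite \<times> 'n) + ('n \<times> (real^2) set)) set) \<noteq> {}"
proof -
  have "Q \<noteq> {}" "Q \<noteq> UNIV"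
    using assms convex_polygonD(2)[OF assms] by (auto simp: convex_polygon_def)
  then have "\<exists>e. e edge_of Q"
    using frontier_convex_polygon[OF assms] frontier_not_empty[of Q] by auto
  then show ?thesis by (auto simp: constraints_def)
qed

lemma H_SP_le:
  fixes P :: "(real^2)^'n"
  assumes "convex_polygon Q" "c \<in> constraints Q"
  shows "H_SP Q P \<le> separation c P"
  unfolding H_SP_eq_Min using assms finite_constraints by (intro Min_le) auto

lemma H_SP_le_pair:
  fixes P :: "(real^2)^'n"
  assumes "convex_polygon Q" "i \<noteq> j"
  shows "H_SP Q P \<le> 1/2 * norm (P $ i - P $ j)"
  using H_SP_le[OF assms(1), of "Inl (i, j)" P] assms(2)
  by (simp add: constraints_def separation_def)

lemma H_SP_le_edge:
  fixes P :: "(real^2)^'n"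
  assumes "convex_polygon Q" "e edge_of Q"
  shows "H_SP Q P \<le> infdist (P $ i) e"
  using H_SP_le[OF assms(1), of "Inr (i, e)" P] assms(2)
  by (simp add: constraints_def separation_def)

lemma H_SP_attained:
  fixes P :: "(real^2)^'n"
  assumes "convex_polygon Q"
  obtains c where "c \<in> constraints Q" "separation c P = H_SP Q P"
proof -
  have "H_SP Q P \<in> (\<lambda>c. separation c P) ` constraints Q"
    unfolding H_SP_eq_Min
    by (intro Min_in finite_imageI finite_constraints[OF assms])
       (simp add: constraints_nonempty[OF assms])
  then show thesis using that by auto
qed

lemma H_SP_nonneg:
  fixes P :: "(real^2)^'n"
  assumes "convex_polygon Q"
  shows "0 \<le> H_SP Q P"
proof -
  obtain c where "c \<in> constraints Q" "separation c P = H_SP Q P"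
    using H_SP_attained[OF assms] .
  moreover have "0 \<le> separation c P"
    by (simp add: separation_def infdist_nonneg split: sum.split prod.split)
  ultimately show ?thesis by simp
qed

text \<open>This trades the distance to \<open>e\<close> for an affine function of \<open>P\<close>;
  the edge that yields the bound may differ from \<open>e\<close>.\<close>

lemma H_SP_le_slack:
  fixes P :: "(real^2)^'n"
  assumes Q: "convex_polygon Q" and "P \<in> configurations Q" and ab: "edge_line Q e a b"
  shows "H_SP Q P \<le> b - a \<bullet> P $ i"
proof -
  have "P $ i \<in> Q" using assms(2) by (simp add: configurations_def)
  then obtain e' where "e' edge_of Q" "infdist (P $ i) e' \<le> b - a \<bullet> P $ i"
    using infdist_edge_le_slack[OF Q _ ab] by blast
  then show ?thesis using H_SP_le_edge[OF Q, of e' P i] by linarith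
qed

lemma tendsto_separation:
  assumes "(X \<longlongrightarrow> P) F"
  shows "((\<lambda>k. separation c (X k)) \<longlongrightarrow> separation c P) F"
  unfolding separation_def using assms
  by (auto split: sum.split prod.split intro!: tendsto_intros)

section \<open>Limits of gradients\<close>

text \<open>The difference \<open>h - f\<close> has a local minimum at \<open>x\<close>, so its
  derivative vanishes. The set \<open>U\<close> admits bounds that hold only on configurations in
  \<open>Q\<close>.\<close>

lemma GDERIV_eq_of_touching_above:
  fixes f h :: "'a::real_inner \<Rightarrow> real"
  assumes f: "GDERIV f x :> g" and h: "(h has_derivative L) (at x)"
    and "open U" "x \<in> U" "\<And>y. y \<in> U \<Longrightarrow> f y \<le> h y" "f x = h x"
  shows "g \<bullet> v = L v"
proof -
  have "((\<lambda>y. h y - f y) has_derivative (\<lambda>v. L v - v \<bullet> g)) (at x)"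
    using f h unfolding gderiv_def by (rule has_derivative_diff[rotated])
  then have "(\<lambda>v. L v - v \<bullet> g) = (\<lambda>v. 0)"
    using assms(5,6) by (intro has_derivative_local_min) (auto simp: eventually_at_filter
      eventually_nhds intro!: exI[of _ U] assms)
  then show ?thesis by (simp add: fun_eq_iff inner_commute)
qed

text \<open>When the two generators of a pair coincide, the limit direction of their difference is
  not determined by \<open>P\<close>, but the limit gradient still ignores common translations of them.\<close>
definition active_slope ::
    "(real^2) set \<Rightarrow> ('n \<times> 'n) + ('n \<times> (real^2) set) \<Rightarrow> (real^2)^'n \<Rightarrow> (real^2)^'n \<Rightarrow> bool" where
  "active_slope Q c P g = (case c of
      Inl (i, j) \<Rightarrow> (\<forall>v. v $ i = v $ j \<longrightarrow> g \<bullet> v = 0)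
        \<and> (P $ i \<noteq> P $ j \<longrightarrow> (\<forall>v. g \<bullet> v = 1/2 * (sgn (P $ i - P $ j) \<bullet> (v $ i - v $ j))))
    | Inr (i, e) \<Rightarrow> (\<forall>a b v. edge_line Q e a b \<longrightarrow> g \<bullet> v = - (a \<bullet> v $ i)))"

lemma active_slope_gradient:
  fixes X :: "(real^2)^'n"
  assumes Q: "convex_polygon Q" and X: "X \<in> interior (configurations Q)"
    and g: "GDERIV (H_SP Q) X :> g"
    and c: "c \<in> constraints Q" "separation c X = H_SP Q X"
  shows "active_slope Q c X g"
proof (cases c)
  case (Inl p)
  then obtain i j where p: "c = Inl (i, j)" "i \<noteq> j"
    using c by (auto simp: constraints_def)
  have HX: "H_SP Q X = 1/2 * norm (X $ i - X $ j)"
    using c p by (simp add: separation_def)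
  show ?thesis
  proof (cases "X $ i = X $ j")
    case True
    \<comment> \<open>Here \<open>H_SP Q X = 0\<close> is the least possible value, so the constant
      0 touches \<open>- H_SP Q\<close> from above.\<close>
    have "(-g) \<bullet> v = 0" for v
    proof (rule GDERIV_eq_of_touching_above[OF _ _ open_UNIV])
      show "GDERIV (\<lambda>Y. - H_SP Q Y) X :> - g"
        using g by (rule GDERIV_minus)
      show "((\<lambda>_. 0::real) has_derivative (\<lambda>_. 0)) (at X)" by simp
    qed (use True HX H_SP_nonneg[OF Q] in auto)
    then show ?thesis using True p by (simp add: active_slope_def)
  next
    case False
    have gv: "g \<bullet> v = 1/2 * (sgn (X $ i - X $ j) \<bullet> (v $ i - v $ j))" for v
    proof (rule GDERIV_eq_of_touching_above[OF g _ open_UNIV])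
      have "((\<lambda>Y. Y $ i - Y $ j) has_derivative (\<lambda>v. v $ i - v $ j)) (at X)"
        by (intro has_derivative_diff bounded_linear_imp_has_derivative bounded_linear_vec_nth)
      moreover have "(norm has_derivative (\<lambda>h. h \<bullet> sgn (X $ i - X $ j))) (at (X $ i - X $ j))"
        using False by (intro has_derivative_norm) simp
      ultimately have "((\<lambda>Y. norm (Y $ i - Y $ j)) has_derivative
          (\<lambda>v. (v $ i - v $ j) \<bullet> sgn (X $ i - X $ j))) (at X)"
        by (rule has_derivative_compose)
      then show "((\<lambda>Y. 1/2 * norm (Y $ i - Y $ j)) has_derivative
          (\<lambda>v. 1/2 * (sgn (X $ i - X $ j) \<bullet> (v $ i - v $ j)))) (at X)"
        unfolding inner_commute[of "sgn (X $ i - X $ j)"] by (rule has_derivative_mult_right)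
    qed (use HX H_SP_le_pair[OF Q \<open>i \<noteq> j\<close>] in auto)
    show ?thesis using False p by (simp add: active_slope_def gv)
  qed
next
  case (Inr p)
  then obtain i e where p: "c = Inr (i, e)" "e edge_of Q"
    using c by (auto simp: constraints_def)
  have HX: "H_SP Q X = infdist (X $ i) e"
    using c p by (simp add: separation_def)
  have "g \<bullet> v = - (a \<bullet> v $ i)" if ab: "edge_line Q e a b" for a b v
  proof (rule GDERIV_eq_of_touching_above[OF g _ open_interior X])
    have "((\<lambda>Y. b - a \<bullet> Y $ i) has_derivative (\<lambda>v. 0 - a \<bullet> v $ i)) (at X)"
      by (intro has_derivative_diff has_derivative_const has_derivative_inner_right
          bounded_linear_imp_has_derivative bounded_linear_vec_nth)
    then show "((\<lambda>Y. b - a \<bullet> Y $ i) has_derivative (\<lambda>v. - (a \<bullet> v $ i))) (at X)"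
      by simp
    \<comment> \<open>The slack is squeezed: it is at most the distance to \<open>e\<close>, which
      equals \<open>H_SP Q X\<close>, which is at most the slack.\<close>
    show "H_SP Q X = b - a \<bullet> X $ i"
      using slack_le_infdist[OF ab edge_nonempty[OF p(2)], of "X $ i"] HX
        H_SP_le_slack[OF Q _ ab, of X i] X interior_subset by fastforce
  qed (use X interior_subset H_SP_le_slack[OF Q _ ab, of _ i] in auto)
  then show ?thesis using p by (auto simp: active_slope_def)
qed

text \<open>By pigeonhole one of the finitely many constraints attains the minimum at infinitely
  many \<open>X k\<close>; along that subsequence its value and slope relations pass to the
  limit.\<close>

lemma limit_gradient:
  fixes P :: "(real^2)^'n"
  assumes Q: "convex_polygon Q"
    and X: "\<And>k. X k \<in> interior (configurations Q) \<and> GDERIV (H_SP Q) (X k) :> df k"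
    and P: "X \<longlonglongrightarrow> P" and g: "df \<longlonglongrightarrow> g"
  obtains c where "c \<in> constraints Q" "separation c P = H_SP Q P" "active_slope Q c P g"
proof -
  let ?K = "\<lambda>c. {k. separation c (X k) = H_SP Q (X k)}"
  have "\<exists>c\<in>constraints Q. k \<in> ?K c" for k
    using H_SP_attained[OF Q, where P = "X k"] by blast
  then have "(\<Union>c\<in>constraints Q. ?K c) = UNIV" by blast
  then have "infinite (\<Union>c\<in>constraints Q. ?K c)" by simp
  then obtain c where c: "c \<in> constraints Q" "infinite (?K c)"
    using finite_UN_I[OF finite_constraints[OF Q], of ?K] by blast
  obtain s :: "nat \<Rightarrow> nat" where s: "strict_mono s" "\<And>n. separation c (X (s n)) = H_SP Q (X (s n))"
    using infinite_enumerate[OF c(2)] by auto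
  have Xs: "(\<lambda>n. X (s n)) \<longlonglongrightarrow> P" and dfs: "(\<lambda>n. df (s n)) \<longlonglongrightarrow> g"
    using LIMSEQ_subseq_LIMSEQ[OF P s(1), unfolded o_def]
      LIMSEQ_subseq_LIMSEQ[OF g s(1), unfolded o_def] .
  have slope: "active_slope Q c (X (s n)) (df (s n))" for n
    using active_slope_gradient[OF Q] X c s by blast
  have "separation c P \<le> separation d P" if "d \<in> constraints Q" for d
    using tendsto_separation[OF Xs] tendsto_separation[OF Xs]
    by (rule LIMSEQ_le) (use s H_SP_le[OF Q that] in auto)
  moreover obtain d where "d \<in> constraints Q" "separation d P = H_SP Q P"
    using H_SP_attained[OF Q] .
  ultimately have "separation c P = H_SP Q P"
    using H_SP_le[OF Q c(1), of P] by force
  moreover have "active_slope Q c P g"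
  proof (cases c)
    case (Inl p)
    obtain i j where p: "c = Inl (i, j)" using Inl by (cases p) auto
    have "g \<bullet> v = 0" if "v $ i = v $ j" for v
    proof -
      have "df (s n) \<bullet> v = 0" for n
        using slope[of n] that p by (simp add: active_slope_def)
      moreover have "(\<lambda>n. df (s n) \<bullet> v) \<longlonglongrightarrow> g \<bullet> v"
        by (intro tendsto_intros dfs)
      ultimately show ?thesis by (simp add: LIMSEQ_const_iff)
    qed
    moreover have "g \<bullet> v = 1/2 * (sgn (P $ i - P $ j) \<bullet> (v $ i - v $ j))"
      if "P $ i \<noteq> P $ j" for v
    proof (rule LIMSEQ_unique)
      have "(\<lambda>n. X (s n) $ i - X (s n) $ j) \<longlonglongrightarrow> P $ i - P $ j"
        by (intro tendsto_intros Xs)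
      \<comment> \<open>The formula with \<open>sgn\<close> holds only for distinct generators,
        which is eventually the case; \<open>sgn\<close> is continuous at the nonzero limit.\<close>
      then have "\<forall>\<^sub>F n in sequentially. X (s n) $ i - X (s n) $ j \<noteq> 0"
        using that by (intro tendsto_imp_eventually_ne) auto
      then have "\<forall>\<^sub>F n in sequentially. df (s n) \<bullet> v
          = 1/2 * (sgn (X (s n) $ i - X (s n) $ j) \<bullet> (v $ i - v $ j))"
        by eventually_elim (use slope p in \<open>simp add: active_slope_def\<close>)
      moreover have "(\<lambda>n. 1/2 * (sgn (X (s n) $ i - X (s n) $ j) \<bullet> (v $ i - v $ j)))
          \<longlonglongrightarrow> 1/2 * (sgn (P $ i - P $ j) \<bullet> (v $ i - v $ j))"
        using that by (intro tendsto_intros tendsto_sgn Xs) auto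
      ultimately show "(\<lambda>n. df (s n) \<bullet> v)
          \<longlonglongrightarrow> 1/2 * (sgn (P $ i - P $ j) \<bullet> (v $ i - v $ j))"
        by (rule tendsto_cong[THEN iffD2])
      show "(\<lambda>n. df (s n) \<bullet> v) \<longlonglongrightarrow> g \<bullet> v"
        by (intro tendsto_intros dfs)
    qed
    ultimately show ?thesis using p by (simp add: active_slope_def)
  next
    case (Inr p)
    obtain i e where p: "c = Inr (i, e)" using Inr by (cases p) auto
    have "g \<bullet> v = - (a \<bullet> v $ i)" if ab: "edge_line Q e a b" for a b v
    proof -
      have "df (s n) \<bullet> v = - (a \<bullet> v $ i)" for n
        using slope[of n] ab p by (auto simp: active_slope_def)
      moreover have "(\<lambda>n. df (s n) \<bullet> v) \<longlonglongrightarrow> g \<bullet> v"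
        by (intro tendsto_intros dfs)
      ultimately show ?thesis by (simp add: LIMSEQ_const_iff)
    qed
    then show ?thesis using p by (auto simp: active_slope_def)
  qed
  ultimately show thesis using that c by blast
qed

section \<open>From the convex hull to a uniform descent rate\<close>

text \<open>Take \<open>\<epsilon>\<close> to be the radius of a ball around 0 in the hull. If no
  \<open>g\<close> worked for \<open>v\<close>, an open half-space would contain \<open>G\<close>,
  hence the hull, yet exclude the point of length \<open>\<epsilon>\<close> opposite to
  \<open>v\<close>.\<close>

lemma zero_interior_hull_imp_descent:
  fixes G :: "'a::real_inner set"
  assumes "0 \<in> interior (convex hull G)"
  obtains \<epsilon> where "\<epsilon> > 0" "\<And>v. v \<noteq> 0 \<Longrightarrow> \<exists>g\<in>G. g \<bullet> v \<le> - \<epsilon> * norm v"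
proof -
  obtain \<epsilon> where \<epsilon>: "\<epsilon> > 0" "cball 0 \<epsilon> \<subseteq> convex hull G"
    using assms by (meson mem_interior_cball)
  have "\<exists>g\<in>G. g \<bullet> v \<le> - \<epsilon> * norm v" if "v \<noteq> 0" for v
  proof (rule ccontr)
    assume "\<not> ?thesis"
    then have "G \<subseteq> {g. v \<bullet> g > - \<epsilon> * norm v}"
      by (auto simp: not_le inner_commute)
    then have "convex hull G \<subseteq> {g. v \<bullet> g > - \<epsilon> * norm v}"
      by (rule hull_minimal) (rule convex_halfspace_gt)
    moreover have "- (\<epsilon> / norm v) *\<^sub>R v \<in> convex hull G"
      using \<epsilon> that by (intro subsetD[OF \<epsilon>(2)]) auto
    ultimately have "v \<bullet> (- (\<epsilon> / norm v) *\<^sub>R v) > - \<epsilon> * norm v" by blast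
    then show False
      using that by (simp add: dot_square_norm power2_eq_square)
  qed
  then show thesis using that \<epsilon> by blast
qed

lemma clarke_gradient_descent:
  fixes P :: "(real^2)^'n"
  assumes Q: "convex_polygon Q"
    and "0 \<in> interior (clarke_gradient (configurations Q) S (H_SP Q) P)"
  obtains \<epsilon> where "\<epsilon> > 0"
    "\<And>v. v \<noteq> 0 \<Longrightarrow> \<exists>c g. c \<in> constraints Q \<and> separation c P = H_SP Q P
        \<and> active_slope Q c P g \<and> g \<bullet> v \<le> - \<epsilon> * norm v"
proof -
  let ?G = "{g. \<exists>X df. (\<forall>k. X k \<in> interior (configurations Q) \<and> X k \<notin> S
                \<and> GDERIV (H_SP Q) (X k) :> df k) \<and> X \<longlonglongrightarrow> P \<and> df \<longlonglongrightarrow> g}"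
  have "0 \<in> interior (convex hull ?G)"
    using assms(2) by (simp add: clarke_gradient_def)
  then obtain \<epsilon> where \<epsilon>: "\<epsilon> > 0" "\<And>v. v \<noteq> 0 \<Longrightarrow> \<exists>g\<in>?G. g \<bullet> v \<le> - \<epsilon> * norm v"
    by (rule zero_interior_hull_imp_descent) (rule that)
  have "\<exists>c g. c \<in> constraints Q \<and> separation c P = H_SP Q P
        \<and> active_slope Q c P g \<and> g \<bullet> v \<le> - \<epsilon> * norm v" if v: "v \<noteq> 0" for v
  proof -
    obtain g where g: "g \<in> ?G" "g \<bullet> v \<le> - \<epsilon> * norm v" using \<epsilon>(2)[OF v] by blast
    then obtain X df where "\<And>k. X k \<in> interior (configurations Q) \<and> GDERIV (H_SP Q) (X k) :> df k"
      "X \<longlonglongrightarrow> P" "df \<longlonglongrightarrow> g" by blast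
    then obtain c where "c \<in> constraints Q" "separation c P = H_SP Q P" "active_slope Q c P g"
      using limit_gradient[OF Q, of X df P g] by blast
    then show ?thesis using g by blast
  qed
  then show thesis using that \<epsilon>(1) by blast
qed

section \<open>Consequences of a descent condition on the active constraints\<close>

text \<open>Contracting all generators towards an interior point of \<open>Q\<close> does not decrease any
  active constraint to first order when \<open>H_SP Q P = 0\<close>.\<close>
lemma H_SP_pos:
  fixes P :: "(real^2)^'n"
  assumes Q: "convex_polygon Q" and P: "P \<in> configurations Q"
    and descent: "\<And>v. v \<noteq> 0 \<Longrightarrow> \<exists>c g. c \<in> constraints Q \<and> separation c P = H_SP Q P
        \<and> active_slope Q c P g \<and> g \<bullet> v < 0"
  shows "0 < H_SP Q P"
proof (rule ccontr)
  assume "\<not> 0 < H_SP Q P"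
  then have H0: "H_SP Q P = 0" using H_SP_nonneg[OF Q, of P] by simp
  \<comment> \<open>The target point \<open>x\<close> must avoid the finitely many generators, which
    ensures that \<open>v\<close> is nonzero.\<close>
  have "infinite (interior Q)"
    using Q finite_imp_not_open[of "interior Q"] by (auto simp: convex_polygon_def)
  then have "\<not> interior Q \<subseteq> range (\<lambda>i. P $ i)"
    by (meson finite finite_imageI finite_subset)
  then obtain x where x: "x \<in> interior Q" "\<And>i. x \<noteq> P $ i" by blast
  define v where "v = (\<chi> i. x - P $ i)"
  have v [simp]: "v $ i = x - P $ i" for i by (simp add: v_def)
  have "v \<noteq> 0" using x(2) v by (metis eq_iff_diff_eq_0 zero_index)
  then obtain c g where c: "c \<in> constraints Q" "separation c P = 0" "active_slope Q c P g"
    and neg: "g \<bullet> v < 0" using descent H0 by metis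
  show False
  proof (cases c)
    case (Inl p)
    obtain i j where p: "c = Inl (i, j)" using Inl by (cases p) auto
    then have "P $ i = P $ j" using c by (simp add: separation_def)
    then have "g \<bullet> v = 0" using c p by (simp add: active_slope_def)
    then show False using neg by simp
  next
    case (Inr p)
    then obtain i e where p: "c = Inr (i, e)" "e edge_of Q"
      using c by (auto simp: constraints_def)
    obtain a b where ab: "edge_line Q e a b" using edge_line_exists[OF Q p(2)] .
    \<comment> \<open>The slack vanishes at the generator and is positive at \<open>x\<close>, so it
      increases along \<open>v\<close>, against the sign of \<open>g \<bullet> v\<close>.\<close>
    have "b - a \<bullet> P $ i \<le> 0"
      using slack_le_infdist[OF ab edge_nonempty[OF p(2)], of "P $ i"] c p
      by (simp add: separation_def)
    moreover have "a \<noteq> 0" using ab by (auto simp: edge_line_def)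
    then have "a \<bullet> x < b"
      using x(1) ab interior_mono[of Q "{x. a \<bullet> x \<le> b}"] by (auto simp: edge_line_def)
    moreover have "g \<bullet> v = - (a \<bullet> (x - P $ i))"
      using c ab p by (auto simp: active_slope_def)
    ultimately show False using neg by (simp add: inner_diff_right)
  qed
qed

section \<open>Strict local maximality\<close>

text \<open>The norm is convex, so its linearization bounds it from below; the upper bound comes
  from expanding the square and \<open>2 * x * y \<le> x\<^sup>2 + y\<^sup>2\<close>.\<close>

lemma norm_add_le_quadratic:
  fixes w h :: "'a::real_inner"
  assumes "w \<noteq> 0"
  shows "norm (w + h) \<le> norm w + sgn w \<bullet> h + (norm h)\<^sup>2 / (2 * norm w)"
proof -
  have w: "norm w > 0" using assms by simp
  have eq: "(norm (w + h))\<^sup>2 = (norm w)\<^sup>2 + 2 * norm w * (sgn w \<bullet> h) + (norm h)\<^sup>2"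
    using w by (simp add: power2_norm_eq_inner inner_add_left inner_add_right
        inner_commute sgn_div_norm)
  have "2 * norm w * norm (w + h) \<le> (norm w)\<^sup>2 + (norm (w + h))\<^sup>2"
    by (rule sum_squares_bound)
  moreover have "norm w * (norm w + sgn w \<bullet> h + (norm h)\<^sup>2 / (2 * norm w))
      = (norm w)\<^sup>2 + norm w * (sgn w \<bullet> h) + (norm h)\<^sup>2 / 2"
    using w by (simp add: field_simps power2_eq_square)
  ultimately have "norm w * norm (w + h) \<le> norm w * (norm w + sgn w \<bullet> h + (norm h)\<^sup>2 / (2 * norm w))"
    unfolding eq by linarith
  then show ?thesis using w by simp
qed

lemma strict_local_max_H_SP:
  fixes P :: "(real^2)^'n"
  assumes Q: "convex_polygon Q" and P: "P \<in> configurations Q"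
    and pos: "0 < H_SP Q P" and \<epsilon>: "\<epsilon> > 0"
    and descent: "\<And>v. v \<noteq> 0 \<Longrightarrow> \<exists>c g. c \<in> constraints Q \<and> separation c P = H_SP Q P
        \<and> active_slope Q c P g \<and> g \<bullet> v \<le> - \<epsilon> * norm v"
  shows "strict_local_max_on (configurations Q) (H_SP Q) P"
proof -
  define r where "r = H_SP Q P"
  \<comment> \<open>For a pair, \<open>norm w = 2 * r\<close> and
    \<open>norm h \<le> 2 * norm v\<close> bound the quadratic remainder by
    \<open>(norm v)^2 / r\<close>. The linear term is at most
    \<open>- 2 * \<epsilon> * norm v\<close>, so it wins when
    \<open>norm v < 2 * r * \<epsilon>\<close>.\<close>
  have "H_SP Q Y < r" if Y: "Y \<in> configurations Q" "Y \<noteq> P" "dist Y P < 2 * r * \<epsilon>" for Y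
  proof -
    define v where "v = Y - P"
    have v: "v \<noteq> 0" "norm v < 2 * r * \<epsilon>" and Yv: "Y = P + v"
      using Y by (auto simp: v_def dist_norm)
    obtain c g where c: "c \<in> constraints Q" "separation c P = r" "active_slope Q c P g"
      and neg: "g \<bullet> v \<le> - \<epsilon> * norm v"
      using descent[OF v(1)] r_def by blast
    show ?thesis
    proof (cases c)
      case (Inl p)
      then obtain i j where p: "c = Inl (i, j)" "i \<noteq> j"
        using c by (auto simp: constraints_def)
      define w h where "w = P $ i - P $ j" and "h = v $ i - v $ j"
      have w: "norm w = 2 * r" using c p by (simp add: separation_def w_def)
      then have "w \<noteq> 0" using pos r_def by auto
      then have gv: "g \<bullet> v = 1/2 * (sgn w \<bullet> h)"
        using c p by (simp add: active_slope_def w_def h_def)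
      have "norm h \<le> norm (v $ i) + norm (v $ j)"
        unfolding h_def by (rule norm_triangle_ineq4)
      also have "\<dots> \<le> 2 * norm v"
        using Finite_Cartesian_Product.norm_nth_le[of v i] Finite_Cartesian_Product.norm_nth_le[of v j] by simp
      finally have "(norm h)\<^sup>2 \<le> (2 * norm v)\<^sup>2" by (intro power_mono) auto
      also have "\<dots> = 4 * norm v * norm v" by (simp add: power2_eq_square)
      also have "\<dots> < 4 * norm v * (2 * r * \<epsilon>)"
        using v by (intro mult_strict_left_mono) auto
      finally have "(norm h)\<^sup>2 / (2 * norm w) < 2 * \<epsilon> * norm v"
        using pos by (simp add: w r_def divide_simps mult_ac)
      then have "norm (w + h) < norm w"
        using norm_add_le_quadratic[OF \<open>w \<noteq> 0\<close>, of h] neg gv by simp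
      moreover have "w + h = Y $ i - Y $ j" by (simp add: w_def h_def Yv)
      ultimately show ?thesis
        using H_SP_le_pair[OF Q p(2), of Y] w by simp
    next
      case (Inr p)
      then obtain i e where p: "c = Inr (i, e)" "e edge_of Q"
        using c by (auto simp: constraints_def)
      obtain a b where ab: "edge_line Q e a b" using edge_line_exists[OF Q p(2)] .
      have "b - a \<bullet> P $ i \<le> r"
        using slack_le_infdist[OF ab edge_nonempty[OF p(2)], of "P $ i"] c p
        by (simp add: separation_def)
      moreover have "g \<bullet> v = - (a \<bullet> v $ i)"
        using c ab p by (auto simp: active_slope_def)
      moreover have "0 < \<epsilon> * norm v" using \<epsilon> v by simp
      ultimately have "b - a \<bullet> Y $ i < r"
        using neg by (simp add: Yv inner_add_right)
      then show ?thesis using H_SP_le_slack[OF Q Y(1) ab, of i] by simp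
    qed
  qed
  moreover have "2 * r * \<epsilon> > 0" using pos \<epsilon> by (simp add: r_def)
  ultimately show ?thesis
    using P unfolding strict_local_max_on_def r_def by blast
qed

text \<open>Testing the descent condition with displacements of a single generator \<open>i\<close>.\<close>
lemma voronoi_cell_halfplane:
  fixes P :: "(real^2)^'n"
  assumes Q: "convex_polygon Q" and pos: "0 < H_SP Q P" and "w \<noteq> 0"
    and descent: "\<And>v. v \<noteq> 0 \<Longrightarrow> \<exists>c g. c \<in> constraints Q \<and> separation c P = H_SP Q P
        \<and> active_slope Q c P g \<and> g \<bullet> v < 0"
  obtains u where "norm u = 1" "u \<bullet> w > 0"
    "\<And>q. q \<in> voronoi_cell Q P i \<Longrightarrow> u \<bullet> (q - P $ i) \<le> H_SP Q P"
proof -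
  define r where "r = H_SP Q P"
  \<comment> \<open>The bisector of two generators at distance \<open>2 * r\<close> lies at distance
    \<open>r\<close> from each.\<close>
  have bisector: "u \<bullet> (q - P $ i) \<le> r"
    if q: "q \<in> voronoi_cell Q P i" and "k \<noteq> i" and u: "norm u = 1" "P $ k - P $ i = (2 * r) *\<^sub>R u"
    for q k u
  proof -
    define y where "y = q - P $ i"
    have "norm y \<le> norm (y - (2 * r) *\<^sub>R u)"
      using q \<open>k \<noteq> i\<close> by (auto simp: voronoi_cell_def y_def u(2)[symmetric])
    then have "(norm y)\<^sup>2 \<le> (norm (y - (2 * r) *\<^sub>R u))\<^sup>2" by (simp add: power_mono)
    moreover have "u \<bullet> u = 1" using u by (simp add: dot_square_norm)
    ultimately have "r * (u \<bullet> y) \<le> r * r"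
      by (simp add: power2_norm_eq_inner inner_diff_left inner_diff_right inner_commute)
    then show ?thesis using pos by (simp add: r_def y_def)
  qed
  have "axis i w \<noteq> 0" using \<open>w \<noteq> 0\<close> by (simp add: axis_eq_0_iff)
  then obtain c g where c: "c \<in> constraints Q" "separation c P = r" "active_slope Q c P g"
    and neg: "g \<bullet> axis i w < 0" using descent r_def by metis
  have "\<exists>u. norm u = 1 \<and> u \<bullet> w > 0 \<and> (\<forall>q\<in>voronoi_cell Q P i. u \<bullet> (q - P $ i) \<le> r)"
  proof (cases c)
    case (Inl p)
    then obtain j k where p: "c = Inl (j, k)" "j \<noteq> k"
      using c by (auto simp: constraints_def)
    define d where "d = P $ j - P $ k"
    have d: "norm d = 2 * r" using c p by (simp add: separation_def d_def)
    then have "d \<noteq> 0" using pos r_def by auto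
    then have n1: "norm (sgn d) = 1" "d = (2 * r) *\<^sub>R sgn d"
      using d pos \<open>d \<noteq> 0\<close> by (simp_all add: norm_sgn sgn_div_norm r_def)
    have gv: "g \<bullet> axis i w = 1/2 * (sgn d \<bullet> (axis i w $ j - axis i w $ k))"
      using c p \<open>d \<noteq> 0\<close> by (simp add: active_slope_def d_def)
    \<comment> \<open>The outer normal points from generator \<open>i\<close> to its partner, so its
      sign depends on the position of \<open>i\<close> in the pair. A pair without \<open>i\<close>
      has zero slope, which contradicts \<open>neg\<close>.\<close>
    consider "i = j" | "i = k" | "i \<noteq> j" "i \<noteq> k" by blast
    then show ?thesis
    proof cases
      case 1
      then have "(- sgn d) \<bullet> w > 0" using gv neg p by (simp add: axis_def)
      moreover have "P $ k - P $ i = (2 * r) *\<^sub>R (- sgn d)"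
        using n1(2) 1 by (simp add: d_def)
      ultimately show ?thesis
        using bisector[of _ k "- sgn d"] n1 1 p by (intro exI[of _ "- sgn d"]) auto
    next
      case 2
      then have "sgn d \<bullet> w > 0" using gv neg p by (simp add: axis_def)
      moreover have "P $ j - P $ i = (2 * r) *\<^sub>R sgn d"
        using n1(2) 2 by (simp add: d_def)
      ultimately show ?thesis
        using bisector[of _ j "sgn d"] n1 2 p by (intro exI[of _ "sgn d"]) auto
    next
      case 3
      then show ?thesis using gv neg by (simp add: axis_def)
    qed
  next
    case (Inr p)
    then obtain j e where p: "c = Inr (j, e)" "e edge_of Q"
      using c by (auto simp: constraints_def)
    obtain a b where ab: "edge_line Q e a b" using edge_line_exists[OF Q p(2)] .
    have slack: "b - a \<bullet> P $ j \<le> r"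
      using slack_le_infdist[OF ab edge_nonempty[OF p(2)], of "P $ j"] c p
      by (simp add: separation_def)
    have "g \<bullet> axis i w = - (a \<bullet> axis i w $ j)"
      using c ab p by (auto simp: active_slope_def)
    then have "j = i" "a \<bullet> w > 0"
      using neg by (auto simp: axis_def split: if_splits)
    moreover have "a \<bullet> (q - P $ i) \<le> r" if "q \<in> voronoi_cell Q P i" for q
    proof -
      have "a \<bullet> q \<le> b" using that ab by (auto simp: voronoi_cell_def edge_line_def)
      then show ?thesis using slack \<open>j = i\<close> by (simp add: inner_diff_right)
    qed
    ultimately show ?thesis using ab by (auto simp: edge_line_def)
  qed
  then show thesis using that r_def by auto
qed

section \<open>Disks inscribed in the Voronoi cells\<close>

text \<open>Edge distances keep the disk inside \<open>Q\<close>. The other generators are at least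
  \<open>2 * H_SP Q P\<close> away, so by the triangle inequality none is closer.\<close>

lemma ball_subset_voronoi_cell:
  fixes P :: "(real^2)^'n"
  assumes Q: "convex_polygon Q" and P: "P \<in> configurations Q"
  shows "ball (P $ i) (H_SP Q P) \<subseteq> voronoi_cell Q P i"
proof
  fix q assume q: "q \<in> ball (P $ i) (H_SP Q P)"
  have "ball (P $ i) (H_SP Q P) \<subseteq> Q"
    using P by (intro ball_subset_convex_polygon[OF Q] H_SP_le_edge[OF Q])
      (auto simp: configurations_def)
  moreover have "norm (q - P $ i) \<le> norm (q - P $ j)" if "j \<noteq> i" for j
  proof -
    have "2 * H_SP Q P \<le> norm (P $ j - P $ i)"
      using H_SP_le_pair[OF Q that, of P] by simp
    also have "\<dots> \<le> norm (q - P $ i) + norm (q - P $ j)"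
      using norm_triangle_ineq4[of "q - P $ i" "q - P $ j"] by simp
    finally show ?thesis
      using q by (simp add: dist_norm norm_minus_commute)
  qed
  ultimately show "q \<in> voronoi_cell Q P i" using q by (auto simp: voronoi_cell_def)
qed

lemma closed_voronoi_cell:
  assumes "closed Q"
  shows "closed (voronoi_cell Q P i)"
proof -
  have "voronoi_cell Q P i
      = Q \<inter> (\<Inter>j\<in>{j. j \<noteq> i}. {q. norm (q - P $ i) \<le> norm (q - P $ j)})"
    by (auto simp: voronoi_cell_def)
  moreover have "closed {q. norm (q - P $ i) \<le> norm (q - P $ j)}" for j
    by (intro closed_Collect_le continuous_intros)
  ultimately show ?thesis using assms by (auto intro!: closed_Int closed_INT)
qed

text \<open>The inscribed disk gives \<open>F_SP \<ge> H_SP\<close>. The point at distance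
  \<open>H_SP Q P\<close> along \<open>u\<close> lies on the bounding line, hence outside the
  interior of the cell, which gives the other inequality.\<close>

lemma active_of_halfplane:
  fixes P :: "(real^2)^'n"
  assumes Q: "convex_polygon Q" and P: "P \<in> configurations Q" and u: "norm u = 1"
    and cell: "\<And>q. q \<in> voronoi_cell Q P i \<Longrightarrow> u \<bullet> (q - P $ i) \<le> H_SP Q P"
  shows "active Q P i"
proof -
  define r where "r = H_SP Q P"
  have uu: "u \<bullet> u = 1" "u \<noteq> 0" using u by (auto simp: dot_square_norm)
  define q where "q = P $ i + r *\<^sub>R u"
  have "voronoi_cell Q P i \<subseteq> {x. u \<bullet> x \<le> r + u \<bullet> P $ i}"
    using cell by (fastforce simp: r_def inner_diff_right)
  then have "interior (voronoi_cell Q P i) \<subseteq> {x. u \<bullet> x < r + u \<bullet> P $ i}"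
    using interior_mono interior_halfspace_le[OF uu(2)] by blast
  moreover have "u \<bullet> q = r + u \<bullet> P $ i" using uu by (simp add: q_def inner_add_right)
  ultimately have q: "q \<in> - interior (voronoi_cell Q P i)" by auto
  have "F_SP Q P i \<le> dist (P $ i) q"
    unfolding F_SP_def using q by (rule infdist_le)
  also have "\<dots> = r"
    using u H_SP_nonneg[OF Q, of P] by (simp add: q_def dist_norm r_def)
  finally have "F_SP Q P i \<le> r" .
  moreover have "r \<le> F_SP Q P i"
  proof -
    have "ball (P $ i) r \<subseteq> interior (voronoi_cell Q P i)"
      using ball_subset_voronoi_cell[OF Q P] by (simp add: interior_maximal r_def)
    then have "r \<le> dist (P $ i) x" if "x \<in> - interior (voronoi_cell Q P i)" for x
      using that by (meson ComplD mem_ball not_less subsetD)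
    moreover have "- interior (voronoi_cell Q P i) \<noteq> {}" using q by blast
    ultimately show ?thesis
      unfolding F_SP_def infdist_notempty[OF \<open>- interior (voronoi_cell Q P i) \<noteq> {}\<close>]
      by (intro cINF_greatest)
  qed
  ultimately show ?thesis by (simp add: active_def r_def)
qed

text \<open>A disk in \<open>W\<close> reaches \<open>c' + r' *\<^sub>R u\<close>, so
  \<open>r' + u \<bullet> (c' - p) \<le> r\<close>. Taking \<open>u\<close> for the direction
  \<open>w = c' - p\<close> forces \<open>r' < r\<close> unless \<open>c' = p\<close>.\<close>

lemma incenter_set_eq_singleton:
  fixes W :: "'a::euclidean_space set"
  assumes "0 \<le> r" "cball p r \<subseteq> W"
    and sep: "\<And>w. w \<noteq> 0 \<Longrightarrow> \<exists>u. norm u = 1 \<and> u \<bullet> w > 0 \<and> (\<forall>q\<in>W. u \<bullet> (q - p) \<le> r)"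
  shows "incenter_set W = {p}"
proof -
  have bound: "r' \<le> r - u \<bullet> (c' - p)"
    if "cball c' r' \<subseteq> W" "r' \<ge> 0" "norm u = 1" "\<forall>q\<in>W. u \<bullet> (q - p) \<le> r" for c' r' u
  proof -
    have "c' + r' *\<^sub>R u \<in> W" using that by (intro subsetD[OF that(1)]) (simp add: dist_norm)
    then have "u \<bullet> (c' + r' *\<^sub>R u - p) \<le> r" using that by blast
    moreover have "u \<bullet> u = 1" using that by (simp add: dot_square_norm)
    ultimately show ?thesis by (simp add: inner_diff_right inner_add_right)
  qed
  have lt: "r' < r" if "cball c' r' \<subseteq> W" "r' \<ge> 0" "c' \<noteq> p" for c' r'
    using sep[of "c' - p"] bound[OF that(1,2)] that(3) by force
  have le: "r' \<le> r" if "cball c' r' \<subseteq> W" "r' \<ge> 0" for c' r'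
  proof (cases "c' = p")
    case True
    \<comment> \<open>With \<open>c' = p\<close> the normal \<open>u\<close> from any nonzero
      direction gives \<open>r' \<le> r\<close>.\<close>
    obtain w :: 'a where "w \<noteq> 0" using nonzero_Basis nonempty_Basis by blast
    then show ?thesis using sep[of w] bound[OF that] True by force
  qed (use lt[OF that] in auto)
  show ?thesis
  proof
    show "{p} \<subseteq> incenter_set W" using assms(1,2) le by (auto simp: incenter_set_def)
    show "incenter_set W \<subseteq> {p}"
    proof
      fix c assume "c \<in> incenter_set W"
      then obtain r' where "r' \<ge> 0" "cball c r' \<subseteq> W" "r \<le> r'"
        using assms(1,2) unfolding incenter_set_def by blast
      then show "c \<in> {p}" using lt by force
    qed
  qed
qed

theorem theorem4p8:
  fixes Q :: "(real^2) set" and P :: "(real^2)^'n" and S :: "((real^2)^'n) set"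
  assumes "convex_polygon Q"
    and "P \<in> configurations Q"
    and "negligible S"
    and "0 \<in> interior (clarke_gradient (configurations Q) S (H_SP Q) P)"
  shows "strict_local_max_on (configurations Q) (H_SP Q) P
       \<and> (\<forall>i. active Q P i)
       \<and> generic_incenter_voronoi Q P"
proof -
  note Q = assms(1) and P = assms(2)
  obtain \<epsilon> where \<epsilon>: "\<epsilon> > 0"
    and descent: "\<And>v. v \<noteq> 0 \<Longrightarrow> \<exists>c g. c \<in> constraints Q \<and> separation c P = H_SP Q P
        \<and> active_slope Q c P g \<and> g \<bullet> v \<le> - \<epsilon> * norm v"
    using clarke_gradient_descent[OF Q assms(4)] by blast
  \<comment> \<open>Positivity and the cell bounds use only the sign of the slope; the uniform rate
    serves the strict local maximum.\<close>
  have descent0: "\<exists>c g. c \<in> constraints Q \<and> separation c P = H_SP Q P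
        \<and> active_slope Q c P g \<and> g \<bullet> v < 0" if v: "v \<noteq> 0" for v
  proof -
    have "- \<epsilon> * norm v < 0" using \<epsilon> v by simp
    then show ?thesis using descent[OF v] by (meson order_le_less_trans)
  qed
  have pos: "0 < H_SP Q P" using H_SP_pos[OF Q P descent0] .
  have sep: "\<exists>u. norm u = 1 \<and> u \<bullet> w > 0
      \<and> (\<forall>q\<in>voronoi_cell Q P i. u \<bullet> (q - P $ i) \<le> H_SP Q P)" if "w \<noteq> 0" for w i
    by (rule voronoi_cell_halfplane[OF Q pos that descent0, of i]) auto
  have "active Q P i" for i
    using sep[of "axis 1 1" i] active_of_halfplane[OF Q P] by (auto simp: axis_eq_0_iff)
  moreover have "incenter_set (voronoi_cell Q P i) = {P $ i}" for i
  proof (rule incenter_set_eq_singleton[OF less_imp_le[OF pos] _ sep])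
    \<comment> \<open>The cell is closed and the radius positive, so containment passes from the
      open disk to the closed one.\<close>
    have "closure (ball (P $ i) (H_SP Q P)) \<subseteq> voronoi_cell Q P i"
      using ball_subset_voronoi_cell[OF Q P] closed_voronoi_cell[OF convex_polygonD(3)[OF Q]]
      by (rule closure_minimal)
    then show "cball (P $ i) (H_SP Q P) \<subseteq> voronoi_cell Q P i" using pos by simp
  qed
  ultimately show ?thesis
    using strict_local_max_H_SP[OF Q P pos \<epsilon> descent] by (simp add: generic_incenter_voronoi_def)
qed

end
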